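(* Assume Chang's Conjecture for $\aleph_\omega$. Let $X$ be a regular scattered space. Then $Nt((X^{\aleph_\omega}, \tau_{<\omega_1})) \geq \aleph_2$.
   Context: All topological spaces have at least two points; regular spaces are assumed to be $T_1$. A space is scattered if each of its non-empty subsets has an isolated point (in the subspace topology). For cardinals $\lambda,\kappa,\mu,\tau$, $(\lambda,\kappa)\twoheadrightarrow(\mu,\tau)$ means that for every structure $(A,B,\dots)$ with countable signature (where $B\subseteq A$ is the interpretation of a unary predicate) such that $|A|=\lambda$ and $|B|=\kappa$, there is an elementary substructure $(A',B',\dots)\prec(A,B,\dots)$ with $|A'|=\mu$ and $|B'|=\tau$. Chang's Conjecture for $\aleph_\omega$ is the assertion $(\aleph_{\omega+1},\aleph_\omega)\twoheadrightarrow(\aleph_1,\aleph_0)$. $(X^{\kappa},\tau_{<\omega_1})$ denotes $X^\kappa$ with the topology generated by the sets $\prod_{\alpha<\kappa}W_\alpha$ with each $W_\alpha$ open in $X$ and $|\{\alpha<\kappa: W_\alpha\neq X\}|<\omega_1$. A family $\mathcal{B}$ of sets is $\kappa^{op}$-like (with respect to $\supseteq$) if every bounded subset of $(\mathcal{B},\supseteq)$ has size strictly less than $\kappa$, i.e. for every $B\in\mathcal{B}$, the set $\{C\in\mathcal{B}:B\subseteq C\}$ has cardinality less than $\kappa$. The Noetherian type $Nt(Z)$ of a space $Z$ is the minimum cardinal $\kappa$ such that $Z$ has a $\kappa^{op}$-like base. *)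

theory Defs
  imports "HOL-Analysis.Analysis"
begin

unbundle cardinal_syntax

section \<open>First-order structures and elementary substructures\<close>

text \<open>A symbol belongs to the signature iff its arity is not \<open>None\<close>.
  Constants are function symbols of arity \<open>0\<close>.\<close>

record ('f, 'r) signature =
  fun_arity :: "'f \<Rightarrow> nat option"
  rel_arity :: "'r \<Rightarrow> nat option"

record ('a, 'f, 'r) struct =
  univ :: "'a set"
  fun_interp :: "'f \<Rightarrow> 'a list \<Rightarrow> 'a"
  rel_interp :: "'r \<Rightarrow> 'a list set"

datatype 'f fo_term = Var nat | App 'f "'f fo_term list"

datatype ('f, 'r) fo_form =
    Eq "'f fo_term" "'f fo_term"
  | Rel 'r "'f fo_term list"
  | Neg "('f, 'r) fo_form"
  | And "('f, 'r) fo_form" "('f, 'r) fo_form"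
  | Exi nat "('f, 'r) fo_form"

primrec wf_term :: "('f, 'r) signature \<Rightarrow> 'f fo_term \<Rightarrow> bool" where
  "wf_term \<Sigma> (Var n) \<longleftrightarrow> True"
| "wf_term \<Sigma> (App f ts) \<longleftrightarrow> fun_arity \<Sigma> f = Some (length ts) \<and> list_all (wf_term \<Sigma>) ts"

primrec wf_form :: "('f, 'r) signature \<Rightarrow> ('f, 'r) fo_form \<Rightarrow> bool" where
  "wf_form \<Sigma> (Eq s t) \<longleftrightarrow> wf_term \<Sigma> s \<and> wf_term \<Sigma> t"
| "wf_form \<Sigma> (Rel R ts) \<longleftrightarrow> rel_arity \<Sigma> R = Some (length ts) \<and> list_all (wf_term \<Sigma>) ts"
| "wf_form \<Sigma> (Neg \<phi>) \<longleftrightarrow> wf_form \<Sigma> \<phi>"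
| "wf_form \<Sigma> (And \<phi> \<psi>) \<longleftrightarrow> wf_form \<Sigma> \<phi> \<and> wf_form \<Sigma> \<psi>"
| "wf_form \<Sigma> (Exi n \<phi>) \<longleftrightarrow> wf_form \<Sigma> \<phi>"

primrec term_val :: "('a, 'f, 'r) struct \<Rightarrow> (nat \<Rightarrow> 'a) \<Rightarrow> 'f fo_term \<Rightarrow> 'a" where
  "term_val M e (Var n) = e n"
| "term_val M e (App f ts) = fun_interp M f (map (term_val M e) ts)"

primrec sat :: "('a, 'f, 'r) struct \<Rightarrow> (nat \<Rightarrow> 'a) \<Rightarrow> ('f, 'r) fo_form \<Rightarrow> bool" where
  "sat M e (Eq s t) \<longleftrightarrow> term_val M e s = term_val M e t"
| "sat M e (Rel R ts) \<longleftrightarrow> map (term_val M e) ts \<in> rel_interp M R"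
| "sat M e (Neg \<phi>) \<longleftrightarrow> \<not> sat M e \<phi>"
| "sat M e (And \<phi> \<psi>) \<longleftrightarrow> sat M e \<phi> \<and> sat M e \<psi>"
| "sat M e (Exi n \<phi>) \<longleftrightarrow> (\<exists>a\<in>univ M. sat M (e(n := a)) \<phi>)"

text \<open>Interpretations are only constrained, and only compared, on symbols of the signature and
  argument lists of the right length over the universe.\<close>

definition is_struct :: "('f, 'r) signature \<Rightarrow> ('a, 'f, 'r) struct \<Rightarrow> bool" where
  "is_struct \<Sigma> M \<longleftrightarrow> univ M \<noteq> {} \<and>
     (\<forall>f xs. fun_arity \<Sigma> f = Some (length xs) \<and> set xs \<subseteq> univ M \<longrightarrow> fun_interp M f xs \<in> univ M)"

definition substruct ::
    "('f, 'r) signature \<Rightarrow> ('a, 'f, 'r) struct \<Rightarrow> ('a, 'f, 'r) struct \<Rightarrow> bool" where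
  "substruct \<Sigma> N M \<longleftrightarrow> is_struct \<Sigma> N \<and> is_struct \<Sigma> M \<and> univ N \<subseteq> univ M \<and>
     (\<forall>f xs. fun_arity \<Sigma> f = Some (length xs) \<and> set xs \<subseteq> univ N \<longrightarrow>
        fun_interp N f xs = fun_interp M f xs) \<and>
     (\<forall>R xs. rel_arity \<Sigma> R = Some (length xs) \<and> set xs \<subseteq> univ N \<longrightarrow>
        (xs \<in> rel_interp N R \<longleftrightarrow> xs \<in> rel_interp M R))"

definition elem_substruct ::
    "('f, 'r) signature \<Rightarrow> ('a, 'f, 'r) struct \<Rightarrow> ('a, 'f, 'r) struct \<Rightarrow> bool" where
  "elem_substruct \<Sigma> N M \<longleftrightarrow> substruct \<Sigma> N M \<and>
     (\<forall>\<phi> e. wf_form \<Sigma> \<phi> \<and> range e \<subseteq> univ N \<longrightarrow> (sat N e \<phi> \<longleftrightarrow> sat M e \<phi>))"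

definition unary_interp :: "('a, 'f, 'r) struct \<Rightarrow> 'r \<Rightarrow> 'a set" where
  "unary_interp M P = {a \<in> univ M. [a] \<in> rel_interp M P}"


section \<open>Cardinals and Chang's Conjecture\<close>

text \<open>Cardinals are represented, as in the library, by relations \<open>r\<close> with \<open>Card_order r\<close>.

  \<open>chang_arrow \<theta> \<kappa> \<mu> \<tau>\<close> is \<open>(\<theta>, \<kappa>) \<rightarrow>\<rightarrow> (\<mu>, \<tau>)\<close>. A countable signature is, up to
  renaming, one whose function and relation symbols are natural numbers; a structure of size \<open>\<theta>\<close>
  is, up to isomorphism, one whose universe is a set of elements of the type underlying \<open>\<theta>\<close>.
  The relation symbol \<open>P\<close> is the distinguished unary predicate.\<close>

definition chang_arrow :: "'a rel \<Rightarrow> 'k rel \<Rightarrow> 'm rel \<Rightarrow> 't rel \<Rightarrow> bool" where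
  "chang_arrow \<theta> \<kappa> \<mu> \<tau> \<longleftrightarrow>
     (\<forall>(\<Sigma> :: (nat, nat) signature) (M :: ('a, nat, nat) struct) P.
        is_struct \<Sigma> M \<and> rel_arity \<Sigma> P = Some 1 \<and>
        |univ M| =o \<theta> \<and> |unary_interp M P| =o \<kappa> \<longrightarrow>
        (\<exists>N. elem_substruct \<Sigma> N M \<and> |univ N| =o \<mu> \<and> |unary_interp N P| =o \<tau>))"

text \<open>\<open>is_aleph n r\<close>: the relation \<open>r\<close> is a cardinal equal to \<open>\<aleph>\<^sub>n\<close>. No generality is lost by
  taking all the smaller cardinals on the same type, since they embed into the field of \<open>r\<close>.\<close>

primrec is_aleph :: "nat \<Rightarrow> 'a rel \<Rightarrow> bool" where
  "is_aleph 0 r \<longleftrightarrow> Card_order r \<and> r =o natLeq"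
| "is_aleph (Suc n) r \<longleftrightarrow> Card_order r \<and> (\<exists>s :: 'a rel. is_aleph n s \<and> r =o cardSuc s)"

text \<open>\<open>\<aleph>\<^sub>\<omega>\<close> is the supremum of the \<open>\<aleph>\<^sub>n\<close>. The second conjunct also says that every \<open>\<aleph>\<^sub>n\<close> is
  realised on the type \<open>'a\<close>, which a type need not satisfy.\<close>

definition is_aleph_omega :: "'a rel \<Rightarrow> bool" where
  "is_aleph_omega r \<longleftrightarrow> Card_order r \<and>
     (\<forall>n. \<exists>s :: 'a rel. is_aleph n s \<and> s \<le>o r) \<and>
     (\<forall>r' :: 'a rel. Card_order r' \<and> (\<forall>n (s :: 'a rel). is_aleph n s \<longrightarrow> s \<le>o r') \<longrightarrow> r \<le>o r')"


section \<open>Topology\<close>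

definition scattered_space :: "'a topology \<Rightarrow> bool" where
  "scattered_space X \<longleftrightarrow>
     (\<forall>S. S \<subseteq> topspace X \<and> S \<noteq> {} \<longrightarrow> (\<exists>x\<in>S. openin (subtopology X S) {x}))"

text \<open>The space \<open>(X\<^sup>I, \<tau>\<^bsub><\<nu>\<^esub>)\<close>; its points are the extensional functions on \<open>I\<close>.\<close>

definition power_topology_less :: "'n rel \<Rightarrow> 'i set \<Rightarrow> 'a topology \<Rightarrow> ('i \<Rightarrow> 'a) topology" where
  "power_topology_less \<nu> I X = topology_generated_by
     {PiE I W | W. (\<forall>i\<in>I. openin X (W i)) \<and> |{i \<in> I. W i \<noteq> topspace X}| <o \<nu>}"

definition is_base :: "'a topology \<Rightarrow> 'a set set \<Rightarrow> bool" where
  "is_base Z \<B> \<longleftrightarrow> (\<forall>B\<in>\<B>. openin Z B) \<and> (\<forall>U. openin Z U \<longrightarrow> (\<exists>\<U>\<subseteq>\<B>. U = \<Union>\<U>))"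

definition op_like :: "'k rel \<Rightarrow> 'a set set \<Rightarrow> bool" where
  "op_like \<kappa> \<B> \<longleftrightarrow> (\<forall>B\<in>\<B>. |{C \<in> \<B>. B \<subseteq> C}| <o \<kappa>)"

definition has_op_like_base :: "'a topology \<Rightarrow> 'k rel \<Rightarrow> bool" where
  "has_op_like_base Z \<kappa> \<longleftrightarrow> (\<exists>\<B>. is_base Z \<B> \<and> op_like \<kappa> \<B>)"

text \<open>The minimum is taken over the cardinals on the type \<open>'a set set\<close>. This is no restriction:
  by the lemma below there is always a suitable cardinal on that type, and every smaller
  cardinal is then realised on it as well.\<close>

definition Noetherian_type :: "'a topology \<Rightarrow> 'a set set rel" where
  "Noetherian_type Z = (SOME \<kappa>. Card_order \<kappa> \<and> has_op_like_base Z \<kappa> \<and>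
     (\<forall>\<kappa>' :: 'a set set rel. Card_order \<kappa>' \<and> has_op_like_base Z \<kappa>' \<longrightarrow> \<kappa> \<le>o \<kappa>'))"

lemma ex_op_like_base:
  fixes Z :: "'a topology"
  shows "\<exists>\<kappa> :: 'a set set rel. Card_order \<kappa> \<and> has_op_like_base Z \<kappa>"
proof -
  let ?\<B> = "{U. openin Z U}"
  have "is_base Z ?\<B>"
    unfolding is_base_def by (auto intro: exI[of _ "{U}" for U])
  moreover have "op_like (cardSuc |?\<B>| ) ?\<B>"
    unfolding op_like_def
  proof
    fix B
    have "|{C \<in> ?\<B>. B \<subseteq> C}| \<le>o |?\<B>|" by (rule card_of_mono1) auto
    then show "|{C \<in> ?\<B>. B \<subseteq> C}| <o cardSuc |?\<B>|"
      using cardSuc_greater[OF card_of_Card_order] ordLeq_ordLess_trans by blast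
  qed
  ultimately show ?thesis
    unfolding has_op_like_base_def using cardSuc_Card_order[OF card_of_Card_order] by blast
qed

lemma Noetherian_type:
  fixes Z :: "'a topology"
  shows "Card_order (Noetherian_type Z)" "has_op_like_base Z (Noetherian_type Z)"
    and "Card_order \<kappa> \<Longrightarrow> has_op_like_base Z \<kappa> \<Longrightarrow> Noetherian_type Z \<le>o (\<kappa> :: 'k rel)"
proof -
  let ?R = "{\<kappa> :: 'a set set rel. Card_order \<kappa> \<and> has_op_like_base Z \<kappa>}"
  have "?R \<noteq> {}" using ex_op_like_base by auto
  then have "\<exists>\<kappa>\<in>?R. \<forall>\<kappa>'\<in>?R. \<kappa> \<le>o \<kappa>'"
    by (intro exists_minim_Card_order) auto
  then have "\<exists>\<kappa> :: 'a set set rel. Card_order \<kappa> \<and> has_op_like_base Z \<kappa> \<and>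
     (\<forall>\<kappa>' :: 'a set set rel. Card_order \<kappa>' \<and> has_op_like_base Z \<kappa>' \<longrightarrow> \<kappa> \<le>o \<kappa>')" by auto
  note * = someI_ex[OF this, folded Noetherian_type_def]
  show Nt: "Card_order (Noetherian_type Z)" "has_op_like_base Z (Noetherian_type Z)"
    using * by auto
  assume \<kappa>: "Card_order \<kappa>" "has_op_like_base Z \<kappa>"
  show "Noetherian_type Z \<le>o \<kappa>"
  proof (rule ccontr)
    assume "\<not> Noetherian_type Z \<le>o \<kappa>"
    then have less: "\<kappa> <o Noetherian_type Z"
      using Nt(1) \<kappa>(1) by (metis card_order_on_def not_ordLeq_iff_ordLess)
    have "\<kappa> =o |Field \<kappa>|" using \<kappa>(1) card_of_Field_ordIso ordIso_symmetric by blast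
    moreover obtain f where "inj_on f (Field \<kappa>)"
        "f ` Field \<kappa> \<subseteq> Field (Noetherian_type Z)"
      using card_of_ordLeq[of "Field \<kappa>" "Field (Noetherian_type Z)"]
        card_of_mono2[OF ordLess_imp_ordLeq[OF less]] by blast
    ultimately have iso: "\<kappa> =o |f ` Field \<kappa>|"
      by (meson card_of_ordIsoI inj_on_imp_bij_betw ordIso_transitive)
    have "has_op_like_base Z |f ` Field \<kappa>|"
      using \<kappa>(2) iso unfolding has_op_like_base_def op_like_def
      by (meson ordLess_ordIso_trans)
    then have "Noetherian_type Z \<le>o |f ` Field \<kappa>|"
      using * card_of_Card_order by blast
    then show False
      using less iso by (meson not_ordLess_ordLeq ordIso_ordLeq_trans ordIso_symmetric ordLeq_ordIso_trans)
  qed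
qed

end

theory Submission
  imports Defs "HOL-Library.Countable_Set_Type"
begin

text \<open>Let \<open>x\<close> be an isolated point of \<open>X\<close> and \<open>p\<close> the constant function \<open>x\<close>. The sets \<open>[S]\<close> of all
  functions that agree with \<open>p\<close> on a countable set \<open>S\<close> of coordinates form a local base at \<open>p\<close>,
  and \<open>[S] \<subseteq> [T]\<close> iff \<open>T \<subseteq> S\<close>. Given a base, choose for each member \<open>C\<close> containing \<open>p\<close> a countable
  \<open>S\<^sub>C\<close> with \<open>[S\<^sub>C] \<subseteq> C\<close>. The sets \<open>S\<^sub>C\<close> are cofinal among the countable subsets of \<open>\<aleph>\<^sub>\<omega>\<close>, so by
  diagonalization more than \<open>\<aleph>\<^sub>\<omega>\<close> members contain \<open>p\<close>. Chang's Conjecture, applied to a structure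
  on \<open>\<aleph>\<^bsub>\<omega>+1\<^esub>\<close> whose functions enumerate the sets \<open>S\<^sub>C\<close>, yields \<open>\<aleph>\<^sub>1\<close> many \<open>C\<close> whose \<open>S\<^sub>C\<close> all
  lie in one countable \<open>T\<close>. A member of the base containing \<open>p\<close> and inside \<open>[T]\<close> is then
  contained in uncountably many members.\<close>

section \<open>Alephs and the countable cofinality of aleph_omega\<close>

lemma countable_iff_ordLess_cardSuc_natLeq: "countable S \<longleftrightarrow> |S| <o cardSuc natLeq"
  by (simp add: countable_card_le_natLeq cardSuc_ordLeq_ordLess natLeq_Card_order
      card_of_Card_order)

lemma is_aleph_Card_order: "is_aleph n r \<Longrightarrow> Card_order r"
  by (cases n) auto

text \<open>The predecessor in \<open>is_aleph\<close> is only asserted to exist, so uniqueness goes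
  by induction, through the invariance of \<open>cardSuc\<close> under \<open>=o\<close>.\<close>

lemma is_aleph_unique: "is_aleph n (r :: 'a rel) \<Longrightarrow> is_aleph n (s :: 'a rel) \<Longrightarrow> r =o s"
proof (induction n arbitrary: r s)
  case 0
  then show ?case by (auto intro: ordIso_transitive[OF _ ordIso_symmetric])
next
  case (Suc n)
  then obtain r' s' :: "'a rel" where r': "is_aleph n r'" "r =o cardSuc r'"
      and s': "is_aleph n s'" "s =o cardSuc s'"
    by auto
  note r'(2)
  also have "cardSuc r' =o cardSuc s'"
    using Suc.IH[OF r'(1) s'(1)]
      cardSuc_invar_ordIso[OF is_aleph_Card_order[OF r'(1)] is_aleph_Card_order[OF s'(1)]]
    by simp
  also have "cardSuc s' =o s" using s'(2) by (rule ordIso_symmetric)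
  finally show ?case .
qed

lemma is_aleph_infinite: "is_aleph n (r :: 'a rel) \<Longrightarrow> natLeq \<le>o r"
proof (induction n arbitrary: r)
  case 0
  then show ?case using ordIso_symmetric ordIso_imp_ordLeq by auto
next
  case (Suc n)
  then obtain s :: "'a rel" where "is_aleph n s" "r =o cardSuc s" by auto
  then show ?case
    using Suc.IH is_aleph_Card_order cardSuc_ordLeq ordLeq_transitive ordLeq_ordIso_trans
      ordIso_symmetric by metis
qed

lemma is_aleph_omega_infinite: "is_aleph_omega r \<Longrightarrow> natLeq \<le>o r"
  unfolding is_aleph_omega_def by (meson is_aleph_infinite ordLeq_transitive)

lemma is_aleph_less_aleph_omega:
  fixes r s :: "'a rel"
  assumes "is_aleph_omega r" "is_aleph n s"
  shows "s <o r"
proof -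
  \<comment> \<open>Strictness comes from going one aleph further up.\<close>
  obtain t :: "'a rel" where t: "is_aleph (Suc n) t" "t \<le>o r"
    using assms(1) unfolding is_aleph_omega_def by blast
  then obtain u :: "'a rel" where u: "is_aleph n u" "t =o cardSuc u" by auto
  have "s =o u" using is_aleph_unique assms(2) u(1) by blast
  also have "u <o cardSuc u" using is_aleph_Card_order[OF u(1)] cardSuc_greater by blast
  also have "cardSuc u =o t" using u(2) ordIso_symmetric by blast
  also note t(2)
  finally show ?thesis .
qed

text \<open>Countable cofinality of aleph_omega: the fields of the aleph_n serve as
  \<open>J n\<close>. Their infinity lets them absorb countable sets indexed by them.\<close>

lemma is_aleph_omega_countable_union:
  fixes r :: "'a rel"
  assumes r: "is_aleph_omega r"
  obtains J :: "nat \<Rightarrow> 'a set" where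
    "\<And>n. infinite (J n)" "\<And>n. |J n| <o r" "r \<le>o |\<Union>n. J n|"
proof -
  have "\<forall>n. \<exists>s :: 'a rel. is_aleph n s"
    using r unfolding is_aleph_omega_def by blast
  then obtain s :: "nat \<Rightarrow> 'a rel" where s: "\<And>n. is_aleph n (s n)" by metis
  have iso: "|Field (s n)| =o s n" for n
    using is_aleph_Card_order[OF s] card_of_Field_ordIso by blast
  show ?thesis
  proof (rule that[of "\<lambda>n. Field (s n)"])
    show "infinite (Field (s n))" for n
      using is_aleph_infinite[OF s[of n]] iso[of n]
      by (meson infinite_iff_natLeq_ordLeq ordIso_symmetric ordLeq_ordIso_trans)
    show "|Field (s n)| <o r" for n
      using iso is_aleph_less_aleph_omega[OF r s] ordIso_ordLess_trans by blast
    have "u \<le>o |\<Union>n. Field (s n)|" if "is_aleph n u" for n and u :: "'a rel"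
    proof -
      have "u =o s n" using is_aleph_unique that s by blast
      also have "s n =o |Field (s n)|" using iso ordIso_symmetric by blast
      also have "|Field (s n)| \<le>o |\<Union>n. Field (s n)|" by (rule card_of_mono1) blast
      finally show ?thesis .
    qed
    then show "r \<le>o |\<Union>n. Field (s n)|"
      using r unfolding is_aleph_omega_def by (auto simp: card_of_Card_order)
  qed
qed

text \<open>Diagonalization: split \<open>F\<close> into countably many pieces of size below
  aleph_omega. Each piece leaves some point of \<open>Field r\<close> uncovered; one such point per
  piece makes up \<open>T\<close>.\<close>

lemma ex_countable_not_subset_aleph_omega:
  fixes r :: "'a rel" and S :: "'b \<Rightarrow> 'a set"
  assumes r: "is_aleph_omega r" and F: "|F| \<le>o r" and S: "\<And>C. C \<in> F \<Longrightarrow> countable (S C)"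
  obtains T where "countable T" "T \<subseteq> Field r" "\<And>C. C \<in> F \<Longrightarrow> \<not> T \<subseteq> S C"
proof (cases "F = {}")
  case True
  then show ?thesis using that[of "{}"] by auto
next
  case False
  obtain J :: "nat \<Rightarrow> 'a set" where J: "\<And>n. infinite (J n)" "\<And>n. |J n| <o r" "r \<le>o |\<Union>n. J n|"
    using is_aleph_omega_countable_union[OF r] by blast
  have "|F| \<le>o |\<Union>n. J n|" using F J(3) ordLeq_transitive by blast
  then obtain g where g: "g ` (\<Union>n. J n) = F" using False card_of_ordLeq2 by metis
  \<comment> \<open>Otherwise \<open>|J n|\<close> many countable sets would cover
    \<open>Field r\<close>, whose size exceeds \<open>|J n|\<close>.\<close>
  have "\<exists>x\<in>Field r. x \<notin> (\<Union>j\<in>J n. S (g j))" for n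
  proof (rule ccontr)
    assume "\<not> ?thesis"
    then have "|Field r| \<le>o |\<Union>j\<in>J n. S (g j)|" by (intro card_of_mono1) blast
    also have "|\<Union>j\<in>J n. S (g j)| \<le>o |J n|"
    proof (rule card_of_UNION_ordLeq_infinite[OF J(1)])
      show "|J n| \<le>o |J n|" by (rule card_of_mono1) simp
      have "|S (g j)| \<le>o |J n|" if "j \<in> J n" for j
      proof -
        have "g j \<in> F" using g that by blast
        then have "|S (g j)| \<le>o natLeq" using S countable_card_le_natLeq by blast
        then show ?thesis
          using J(1) infinite_iff_natLeq_ordLeq ordLeq_transitive by blast
      qed
      then show "\<forall>j\<in>J n. |S (g j)| \<le>o |J n|" by blast
    qed
    also note J(2)
    finally have "|Field r| <o r" .
    then show False
      using r card_of_Field_ordIso not_ordLess_ordIso unfolding is_aleph_omega_def by blast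
  qed
  then obtain x where x: "\<And>n. x n \<in> Field r" "\<And>n. x n \<notin> (\<Union>j\<in>J n. S (g j))" by metis
  show ?thesis
  proof (rule that[of "range x"])
    fix C
    assume "C \<in> F"
    then obtain n j where "j \<in> J n" "C = g j" using g by blast
    then show "\<not> range x \<subseteq> S C" using x(2)[of n] by blast
  qed (use x(1) in auto)
qed

section \<open>Applying Chang's Conjecture\<close>

text \<open>A substructure closed under functions that enumerate each \<open>S a\<close> contains a
  copy of \<open>S a\<close> for each of its elements \<open>a\<close>. If the predicate marks the
  copy of \<open>I\<close>, all these sets lie in its countable trace.\<close>

lemma chang_arrow_aleph_1:
  fixes \<theta> :: "'a rel" and \<kappa> :: "'k rel" and I :: "'i set" and S :: "'a \<Rightarrow> 'i set"
  assumes chang: "chang_arrow \<theta> \<kappa> (cardSuc natLeq) natLeq"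
    and \<theta>: "Card_order \<theta>" and I: "|I| =o \<kappa>" "|I| \<le>o \<theta>" "I \<noteq> {}"
    and S: "\<And>a. a \<in> Field \<theta> \<Longrightarrow> countable (S a) \<and> S a \<subseteq> I"
  obtains A T where "A \<subseteq> Field \<theta>" "|A| =o cardSuc natLeq" "countable T" "T \<subseteq> I"
    "\<And>a. a \<in> A \<Longrightarrow> S a \<subseteq> T"
proof -
  have \<theta>': "|Field \<theta>| =o \<theta>" using \<theta> card_of_Field_ordIso by blast
  have "|I| \<le>o |Field \<theta>|" using I(2) \<theta>' ordIso_symmetric ordLeq_ordIso_trans by blast
  \<comment> \<open>\<open>g\<close> places a copy of \<open>I\<close> inside the universe, as the
    predicate must be a subset of it.\<close>
  then obtain g where g: "inj_on g I" "g ` I \<subseteq> Field \<theta>" using card_of_ordLeq by metis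
  obtain i where i: "i \<in> I" using I(3) by blast
  \<comment> \<open>\<open>from_nat_into\<close> enumerates nonempty sets only.\<close>
  define S' where "S' a = insert i (S a)" for a
  have S': "countable (S' a)" "S' a \<subseteq> I" "S' a \<noteq> {}" if "a \<in> Field \<theta>" for a
    using S[OF that] i by (auto simp: S'_def)
  define \<Sigma> :: "(nat, nat) signature" where
    "\<Sigma> = \<lparr>fun_arity = (\<lambda>_. Some 1), rel_arity = (\<lambda>_. Some 1)\<rparr>"
  \<comment> \<open>The function symbol \<open>n\<close> sends \<open>a\<close> to the copy of the
    \<open>n\<close>-th element of \<open>S' a\<close>; relation symbol \<open>0\<close> will be the
    distinguished predicate.\<close>
  define M :: "('a, nat, nat) struct" where
    "M = \<lparr>univ = Field \<theta>, fun_interp = (\<lambda>n xs. g (from_nat_into (S' (hd xs)) n)),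
      rel_interp = (\<lambda>_. (\<lambda>a. [a]) ` g ` I)\<rparr>"
  have "is_struct \<Sigma> M"
    unfolding is_struct_def
  proof (intro conjI allI impI)
    show "univ M \<noteq> {}" using g i by (auto simp: M_def)
    fix n xs
    assume "fun_arity \<Sigma> n = Some (length xs) \<and> set xs \<subseteq> univ M"
    then obtain a where "xs = [a]" "a \<in> Field \<theta>"
      by (cases xs) (auto simp: \<Sigma>_def M_def)
    then show "fun_interp M n xs \<in> univ M"
      using from_nat_into[OF S'(3), of a n] S'(2) g(2) by (auto simp: M_def)
  qed
  moreover have KM: "unary_interp M 0 = g ` I"
    using g(2) by (auto simp: unary_interp_def M_def)
  moreover have "|g ` I| =o \<kappa>"
    using g(1) I(1) by (meson card_of_ordIsoI inj_on_imp_bij_betw ordIso_symmetric ordIso_transitive)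
  moreover have "rel_arity \<Sigma> 0 = Some 1" "|univ M| =o \<theta>"
    using \<theta>' by (auto simp: \<Sigma>_def M_def)
  ultimately obtain N where N: "substruct \<Sigma> N M" "|univ N| =o cardSuc natLeq"
      "|unary_interp N 0| =o natLeq"
    using chang unfolding chang_arrow_def elem_substruct_def by metis
  have sub: "univ N \<subseteq> Field \<theta>" using N(1) by (auto simp: substruct_def M_def)
  have KN: "unary_interp N 0 = g ` I \<inter> univ N"
  proof -
    have "[a] \<in> rel_interp N 0 \<longleftrightarrow> [a] \<in> rel_interp M 0" if "a \<in> univ N" for a
      using N(1) that by (auto simp: substruct_def \<Sigma>_def)
    then show ?thesis by (auto simp: unary_interp_def M_def)
  qed
  \<comment> \<open>The trace of the predicate, pulled back along \<open>g\<close>.\<close>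
  define T where "T = {j \<in> I. g j \<in> univ N}"
  show ?thesis
  proof (rule that[OF sub N(2)])
    have "countable (g ` T)"
    proof (rule countable_subset)
      show "g ` T \<subseteq> unary_interp N 0" unfolding KN T_def by blast
      show "countable (unary_interp N 0)"
        using N(3) countable_card_le_natLeq ordIso_imp_ordLeq by blast
    qed
    moreover have "inj_on g T" using g(1) by (rule inj_on_subset) (auto simp: T_def)
    ultimately show "countable T" using countable_image_inj_on by blast
    show "T \<subseteq> I" by (auto simp: T_def)
    fix a
    assume a: "a \<in> univ N"
    have "g (from_nat_into (S' a) n) \<in> univ N" for n
    proof -
      have "fun_interp N n [a] \<in> univ N" "fun_interp N n [a] = fun_interp M n [a]"
        using N(1) a by (auto simp: substruct_def is_struct_def \<Sigma>_def)
      then show ?thesis by (simp add: M_def)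
    qed
    then have "g ` S' a \<subseteq> univ N"
      using range_from_nat_into[OF S'(3,1), of a] a sub by (metis image_subset_iff rangeE subsetD)
    then show "S a \<subseteq> T"
      using S'(2)[of a] a sub by (auto simp: T_def S'_def)
  qed
qed

section \<open>A local base at a constant function\<close>

text \<open>These are the sets \<open>[S]\<close> of the overview. Coordinates of \<open>S\<close>
  outside \<open>I\<close> have no effect, hence the restriction to subsets of \<open>I\<close>
  below.\<close>

definition agree_on :: "'i set \<Rightarrow> 'a topology \<Rightarrow> 'a \<Rightarrow> 'i set \<Rightarrow> ('i \<Rightarrow> 'a) set" where
  "agree_on I X x S = PiE I (\<lambda>i. if i \<in> S then {x} else topspace X)"

lemma const_in_agree_on: "x \<in> topspace X \<Longrightarrow> restrict (\<lambda>_. x) I \<in> agree_on I X x S"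
  by (auto simp: agree_on_def)

lemma agree_on_antimono: "x \<in> topspace X \<Longrightarrow> S \<subseteq> T \<Longrightarrow> agree_on I X x T \<subseteq> agree_on I X x S"
  unfolding agree_on_def by (rule PiE_mono) auto

text \<open>If \<open>i\<close> were in \<open>T\<close> but not in \<open>S\<close>, the function
  with value \<open>y\<close> at \<open>i\<close> and \<open>x\<close> elsewhere would lie in the
  first set only.\<close>

lemma agree_on_subset_imp:
  assumes sub: "agree_on I X x S \<subseteq> agree_on I X x T"
    and "x \<in> topspace X" "y \<in> topspace X" "x \<noteq> y" "T \<subseteq> I"
  shows "T \<subseteq> S"
proof
  fix i
  assume i: "i \<in> T"
  show "i \<in> S"
  proof (rule ccontr)
    assume "i \<notin> S"
    then have "restrict (\<lambda>j. if j = i then y else x) I \<in> agree_on I X x S"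
      using assms by (auto simp: agree_on_def)
    then have "restrict (\<lambda>j. if j = i then y else x) I \<in> agree_on I X x T" using sub by blast
    then show False using i assms by (auto simp: agree_on_def PiE_iff split: if_splits)
  qed
qed

lemma openin_agree_on:
  assumes "openin X {x}" "countable S"
  shows "openin (power_topology_less (cardSuc natLeq) I X) (agree_on I X x S)"
  unfolding power_topology_less_def agree_on_def
proof (rule topology_generated_by_Basis, intro CollectI exI conjI)
  let ?W = "\<lambda>i. if i \<in> S then {x} else topspace X"
  show "\<forall>i\<in>I. openin X (?W i)" using assms(1) by auto
  have "countable {i \<in> I. ?W i \<noteq> topspace X}"
    using assms(2) by (rule countable_subset[rotated]) auto
  then show "|{i \<in> I. ?W i \<noteq> topspace X}| <o cardSuc natLeq"
    by (simp add: countable_iff_ordLess_cardSuc_natLeq)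
qed simp

text \<open>Induction on the generation of \<open>U\<close>: a box yields its countable support, and
  a binary intersection the union of the two countable sets.\<close>

lemma agree_on_local_base:
  assumes x: "x \<in> topspace X"
    and "openin (power_topology_less (cardSuc natLeq) I X) U" "restrict (\<lambda>_. x) I \<in> U"
  shows "\<exists>S. countable S \<and> S \<subseteq> I \<and> agree_on I X x S \<subseteq> U"
proof -
  let ?p = "restrict (\<lambda>_. x) I"
  let ?G = "{PiE I W | W. (\<forall>i\<in>I. openin X (W i)) \<and>
     |{i \<in> I. W i \<noteq> topspace X}| <o cardSuc natLeq}"
  have "generate_topology_on ?G U"
    using assms(2) unfolding power_topology_less_def openin_topology_generated_by_iff .
  then show ?thesis using assms(3)
  proof (induction U rule: generate_topology_on.induct)
    case Empty
    then show ?case by simp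
  next
    case (Int a b)
    then obtain S T where "countable S" "S \<subseteq> I" "agree_on I X x S \<subseteq> a"
        "countable T" "T \<subseteq> I" "agree_on I X x T \<subseteq> b"
      by blast
    moreover have "agree_on I X x (S \<union> T) \<subseteq> agree_on I X x S"
        "agree_on I X x (S \<union> T) \<subseteq> agree_on I X x T"
      using x by (simp_all add: agree_on_antimono)
    ultimately show ?case by (intro exI[of _ "S \<union> T"]) auto
  next
    case (UN K)
    then obtain k where "k \<in> K" "?p \<in> k" by blast
    then obtain S where "countable S" "S \<subseteq> I" "agree_on I X x S \<subseteq> k"
      using UN.IH by metis
    then show ?case using \<open>k \<in> K\<close> by (intro exI[of _ S]) auto
  next
    case (Basis U)
    then obtain W where W: "U = PiE I W" "\<forall>i\<in>I. openin X (W i)"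
        "|{i \<in> I. W i \<noteq> topspace X}| <o cardSuc natLeq"
      by blast
    have "x \<in> W i" if "i \<in> I" for i
      using Basis.prems that unfolding W(1) by (auto simp: PiE_iff)
    then have "agree_on I X x {i \<in> I. W i \<noteq> topspace X} \<subseteq> U"
      unfolding W(1) agree_on_def by (intro PiE_mono) auto
    then show ?case
      using W(3) by (intro exI[of _ "{i \<in> I. W i \<noteq> topspace X}"])
        (auto simp: countable_iff_ordLess_cardSuc_natLeq)
  qed
qed

section \<open>Refuting bases of small order\<close>

lemma is_base_nbhd:
  assumes "is_base Z \<B>" "openin Z U" "p \<in> U"
  obtains B where "B \<in> \<B>" "p \<in> B" "B \<subseteq> U"
  using assms unfolding is_base_def by blast

lemma not_has_aleph_1_op_like_base:
  fixes r :: "'k rel" and X :: "'x topology"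
  assumes r: "is_aleph_omega r"
    and chang: "chang_arrow (cardSuc r) r (cardSuc natLeq) natLeq"
    and x: "openin X {x}" and y: "y \<in> topspace X" "x \<noteq> y"
  shows "\<not> has_op_like_base (power_topology_less (cardSuc natLeq) (Field r) X) (cardSuc natLeq)"
proof
  let ?I = "Field r"
  let ?Z = "power_topology_less (cardSuc natLeq) ?I X"
  let ?p = "restrict (\<lambda>_. x) ?I"
  assume "has_op_like_base ?Z (cardSuc natLeq)"
  then obtain \<B> where \<B>: "is_base ?Z \<B>" "op_like (cardSuc natLeq) \<B>"
    unfolding has_op_like_base_def by blast
  have xX: "x \<in> topspace X" using openin_subset[OF x] by simp
  have r_Card: "Card_order r" using r unfolding is_aleph_omega_def by blast
  define F where "F = {C \<in> \<B>. ?p \<in> C}"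
  have "\<exists>S. countable S \<and> S \<subseteq> ?I \<and> agree_on ?I X x S \<subseteq> C" if "C \<in> F" for C
    using that \<B>(1) by (intro agree_on_local_base[OF xX]) (auto simp: F_def is_base_def)
  then have "\<exists>S. \<forall>C\<in>F. countable (S C) \<and> S C \<subseteq> ?I \<and> agree_on ?I X x (S C) \<subseteq> C"
    by (intro bchoice) blast
  then obtain S where
    "\<forall>C\<in>F. countable (S C) \<and> S C \<subseteq> ?I \<and> agree_on ?I X x (S C) \<subseteq> C" ..
  then have S: "countable (S C)" "S C \<subseteq> ?I" "agree_on ?I X x (S C) \<subseteq> C" if "C \<in> F" for C
    using that by auto
  have cofinal: "\<exists>C\<in>F. C \<subseteq> agree_on ?I X x T" if T: "countable T" for T
  proof -
    obtain C where "C \<in> \<B>" "?p \<in> C" "C \<subseteq> agree_on ?I X x T"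
      by (rule is_base_nbhd[OF \<B>(1) openin_agree_on[OF x T] const_in_agree_on[OF xX]])
    then show ?thesis by (auto simp: F_def)
  qed
  \<comment> \<open>Diagonalizing against at most aleph_omega many \<open>S C\<close> would
    contradict \<open>cofinal\<close>.\<close>
  have "\<not> |F| \<le>o r"
  proof
    assume "|F| \<le>o r"
    then obtain T where T: "countable T" "T \<subseteq> ?I" "\<And>C. C \<in> F \<Longrightarrow> \<not> T \<subseteq> S C"
      using ex_countable_not_subset_aleph_omega[OF r, of F S] S(1) by blast
    obtain C where C: "C \<in> F" "C \<subseteq> agree_on ?I X x T" using cofinal[OF T(1)] by blast
    then have "agree_on ?I X x (S C) \<subseteq> agree_on ?I X x T" using S(3) by blast
    then have "T \<subseteq> S C" using agree_on_subset_imp xX y T(2) by metis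
    then show False using T(3) C(1) by blast
  qed
  then have "r <o |F|"
    using r_Card not_ordLeq_iff_ordLess card_of_Well_order card_order_on_well_order_on by metis
  then have "cardSuc r \<le>o |F|" using cardSuc_least r_Card card_of_Card_order by blast
  then have "|Field (cardSuc r)| \<le>o |F|"
    using r_Card cardSuc_Card_order card_of_Field_ordIso ordIso_ordLeq_trans by blast
  then obtain h where h: "inj_on h (Field (cardSuc r))" "h ` Field (cardSuc r) \<subseteq> F"
    using card_of_ordLeq by metis
  have I: "|?I| =o r" using r_Card card_of_Field_ordIso by blast
  then have I': "|?I| \<le>o cardSuc r"
    using r_Card cardSuc_ordLeq ordIso_ordLeq_trans by blast
  have "?I \<noteq> {}"
    using is_aleph_omega_infinite[OF r] I
    by (metis finite.emptyI infinite_iff_natLeq_ordLeq ordIso_symmetric ordLeq_ordIso_trans)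
  then obtain A T where A: "A \<subseteq> Field (cardSuc r)" "|A| =o cardSuc natLeq"
      and T: "countable T" "T \<subseteq> ?I" "\<And>a. a \<in> A \<Longrightarrow> S (h a) \<subseteq> T"
    using chang_arrow_aleph_1[OF chang cardSuc_Card_order[OF r_Card] I I', of "S \<circ> h"] S(1,2) h(2)
    by (auto simp: image_subset_iff)
  obtain D where D: "D \<in> F" "D \<subseteq> agree_on ?I X x T" using cofinal[OF T(1)] by blast
  \<comment> \<open>For \<open>C = h a\<close>, the chain is \<open>D\<close>, \<open>[T]\<close>,
    \<open>[S C]\<close>, \<open>C\<close>, each contained in the next.\<close>
  have "h ` A \<subseteq> {C \<in> \<B>. D \<subseteq> C}"
  proof
    fix C
    assume "C \<in> h ` A"
    then obtain a where a: "a \<in> A" "C = h a" by blast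
    then have C: "C \<in> F" using h(2) A(1) by blast
    have "D \<subseteq> agree_on ?I X x (S C)" using D(2) agree_on_antimono[OF xX] T(3) a by blast
    then show "C \<in> {C \<in> \<B>. D \<subseteq> C}" using S(3)[OF C] C by (auto simp: F_def)
  qed
  then have "|h ` A| \<le>o |{C \<in> \<B>. D \<subseteq> C}|" by (rule card_of_mono1)
  moreover have "|{C \<in> \<B>. D \<subseteq> C}| <o cardSuc natLeq"
    using \<B>(2) D(1) unfolding op_like_def F_def by blast
  moreover have "|A| =o |h ` A|"
    using h(1) A(1) by (meson card_of_ordIsoI inj_on_imp_bij_betw inj_on_subset)
  ultimately have "|A| <o cardSuc natLeq"
    using ordIso_ordLeq_trans ordLeq_ordLess_trans by blast
  then show False using A(2) not_ordLess_ordIso by blast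
qed

theorem corollary3p5:
  fixes aleph_w :: "'k rel" and X :: "'x topology"
  assumes "is_aleph_omega aleph_w"
    and "chang_arrow (cardSuc aleph_w) aleph_w (cardSuc natLeq) natLeq"
    and "\<exists>x\<in>topspace X. \<exists>y\<in>topspace X. x \<noteq> y"
    and "regular_space X" and "t1_space X"
    and "scattered_space X"
  shows "cardSuc (cardSuc natLeq) \<le>o
    Noetherian_type (power_topology_less (cardSuc natLeq) (Field aleph_w) X)"
proof (rule ccontr)
  let ?Z = "power_topology_less (cardSuc natLeq) (Field aleph_w) X"
  assume not_le: "\<not> ?thesis"
  have aleph_1: "Card_order (cardSuc natLeq)" using natLeq_Card_order cardSuc_Card_order by blast
  have Nt: "Noetherian_type ?Z \<le>o cardSuc natLeq"
    using not_le aleph_1 Noetherian_type(1)[of ?Z] cardSuc_Card_order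
      cardSuc_ordLeq_ordLess not_ordLeq_iff_ordLess
    by (metis card_order_on_well_order_on)
  \<comment> \<open>Being \<open>op_like\<close> passes to larger cardinals.\<close>
  have base: "has_op_like_base ?Z (cardSuc natLeq)"
    using Noetherian_type(2)[of ?Z] Nt ordLess_ordLeq_trans
    unfolding has_op_like_base_def op_like_def by blast
  \<comment> \<open>Scatteredness is applied to the whole space.\<close>
  obtain x where x: "x \<in> topspace X" "openin X {x}"
    using assms(3,6) unfolding scattered_space_def
    by (metis equals0D subset_refl subtopology_topspace)
  obtain y where y: "y \<in> topspace X" "x \<noteq> y" using assms(3) by metis
  show False using not_has_aleph_1_op_like_base[OF assms(1,2) x(2) y] base by contradiction
qed

end
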